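(* Let $(A,B)$ be an AB configuration. Then the labelling algorithm succeeds on $(A,B)$ — that is, no connected component of $\mathcal{L}(A,B)$ contains both a cell of $\mathrm{Cyl}_i^-\cup\mathrm{II}_{\bar i}$ and a cell of $\mathrm{Cyl}_j^-\cup\mathrm{II}_{\bar j}$ for some $i\ne j$ — if and only if $(A,B)\in\mathscr{AB}$.
   Context: Fix partitions $\mu_1,\mu_2,\mu_3$; for a partition $\lambda$ put $\lambda_t=0$ for $t>\ell(\lambda)$ and identify $\lambda$ with $\{(u,v)\in\mathbb{Z}^2:v\ge0,\ 0\le u<\lambda_{v+1}\}$. Cells are elements of $\mathbb{Z}^3$; cells are adjacent if they differ by $\pm e_i$; connected components of a set of cells are taken with respect to adjacency; $BN(w)=\{w-e_1,w-e_2,w-e_3\}$. Define $\mathrm{Cyl}_1=\{(x,u,v):(u,v)\in\mu_1\}$, $\mathrm{Cyl}_2=\{(v,y,u):(u,v)\in\mu_2\}$, $\mathrm{Cyl}_3=\{(u,v,z):(u,v)\in\mu_3\}$, $\mathrm{Cyl}_i^-=\mathrm{Cyl}_i\setminus\mathbb{Z}^3_{\ge0}$, $\mathrm{I}^-=\bigcup_i\mathrm{Cyl}_i^-$, $\mathrm{II}_{\bar1}=\mathrm{Cyl}_2\cap\mathrm{Cyl}_3\setminus\mathrm{Cyl}_1$, $\mathrm{II}_{\bar2}=\mathrm{Cyl}_3\cap\mathrm{Cyl}_1\setminus\mathrm{Cyl}_2$, $\mathrm{II}_{\bar3}=\mathrm{Cyl}_1\cap\mathrm{Cyl}_2\setminus\mathrm{Cyl}_3$,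 $\mathrm{II}=\bigcup_i\mathrm{II}_{\bar i}$, $\mathrm{III}=\mathrm{Cyl}_1\cap\mathrm{Cyl}_2\cap\mathrm{Cyl}_3$. Labelled box configurations: with $V=\mathbb{C}^3/\mathbb{C}(1,1,1)$ (one copy at each cell), $\langle\mathbf i\rangle$ the line spanned by the image of the $i$-th basis vector, a labelled box configuration is a finite set $B\subseteq\mathrm{I}^-\cup\mathrm{II}\cup\mathrm{III}$ of boxes, a subset $U\subseteq B\cap\mathrm{III}$ of unlabelled boxes, and a line (label) in $V$ for each $w\in(B\cap\mathrm{III})\setminus U$, such that (1) if $w\in\mathrm{I}^-$ and some cell in $BN(w)$ is a box, $w$ is a box; (2) if $w\in\mathrm{II}_{\bar i}$ and some $n\in BN(w)$ is a box not of the form "type III box labelled $\langle\mathbf i\rangle$", $w$ is a box; (3) for $w\in\mathrm{III}$, with $S$ the span of the subspaces induced by boxes in $BN(w)$ (a box in $\mathrm{Cyl}_j^-$ induces $\langle\mathbf j\rangle$, a labelled type III box its label, an unlabelled type III box all of $V$): if $S\ne0$ then $w$ is a box; if $\dim S=1$ then $w$ is labelled $S$ or unlabelled; if $\dim S=2$ then $w$ is unlabelled. An AB configuration is a pair of finite sets $A\subseteq\mathrm{I}^-\cup\mathrm{III}$, $B\subseteq\mathrm{II}\cup\mathrm{III}$ with: $w\in\mathrm{I}^-\cup\mathrm{III}$, $BN(w)\cap A\ne\emptyset\Rightarrow w\in A$; $w\in\mathrm{II}\cup\mathrm{III}$, $BN(w)\cap B\ne\emptyset\Rightarrow w\in B$.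 For a labelled box configuration $\pi$, $AB_{\mathrm{base}}(\pi)=(\text{boxes of }\pi\text{ in }\mathrm{I}^-\cup\mathrm{III},\ \text{type II boxes and unlabelled type III boxes of }\pi)$. $P(A,B)=(A\cup(\mathrm{III}\cap(B\setminus A)),\ B\setminus(\mathrm{III}\cap(B\setminus A)))$, and $\mathscr{AB}$ is the set of AB configurations $(A,B)$ with $P(A,B)=AB_{\mathrm{base}}(\pi)$ for some labelled box configuration $\pi$. The labelling set is $\mathcal{L}(A,B)=(\mathrm{I}^-\cap A)\cup(\mathrm{II}\setminus B)\cup(\mathrm{III}\cap(A\triangle B))$. The labelling algorithm: (step 1) if some connected component of $\mathcal{L}(A,B)$ contains a cell of $\mathrm{Cyl}_i^-\cup\mathrm{II}_{\bar i}$ and a cell of $\mathrm{Cyl}_j^-\cup\mathrm{II}_{\bar j}$ with $i\ne j$, terminate with failure; (step 2) label every component meeting $\mathrm{Cyl}_i^-\cup\mathrm{II}_{\bar i}$ by $i$; (step 3) label each remaining component by a single freely chosen point of $\mathbb{P}(V)$. It succeeds if it does not terminate with failure. *)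

theory Defs
  imports "HOL-Analysis.Analysis"
begin

text \<open>Directions are indexed by the type \<open>3\<close>, whose elements are 1, 2 and 3 (with \<open>3 = 0\<close>).\<close>

definition is_partition :: "nat list \<Rightarrow> bool" where
  "is_partition la \<longleftrightarrow> sorted_wrt (\<ge>) la \<and> 0 \<notin> set la"

definition part :: "nat list \<Rightarrow> nat \<Rightarrow> nat" where
  "part la t = (if 1 \<le> t \<and> t \<le> length la then la ! (t - 1) else 0)"

definition diagram :: "nat list \<Rightarrow> (int \<times> int) set" where
  "diagram la = {(u, v). 0 \<le> v \<and> 0 \<le> u \<and> u < int (part la (nat v + 1))}"

type_synonym cell = "int ^ 3"

definition adjacent :: "cell \<Rightarrow> cell \<Rightarrow> bool" where
  "adjacent w w' \<longleftrightarrow> (\<exists>i. w' = w + axis i 1 \<or> w' = w - axis i 1)"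

definition BN :: "cell \<Rightarrow> cell set" where
  "BN w = {w - axis i 1 | i. True}"

definition cell_components :: "cell set \<Rightarrow> cell set set" where
  "cell_components S =
     S // {(w, w'). w \<in> S \<and> w' \<in> S \<and>
             (w, w') \<in> {(x, y). x \<in> S \<and> y \<in> S \<and> adjacent x y}\<^sup>*}"

definition Cyl :: "(3 \<Rightarrow> nat list) \<Rightarrow> 3 \<Rightarrow> cell set" where
  "Cyl mu i =
     (if i = 1 then {vector [x, u, v] | x u v. (u, v) \<in> diagram (mu 1)}
      else if i = 2 then {vector [v, y, u] | y u v. (u, v) \<in> diagram (mu 2)}
      else {vector [u, v, z] | z u v. (u, v) \<in> diagram (mu 3)})"

definition Cyl_neg :: "(3 \<Rightarrow> nat list) \<Rightarrow> 3 \<Rightarrow> cell set" where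
  "Cyl_neg mu i = Cyl mu i - {w. \<forall>k. 0 \<le> w $ k}"

definition I_neg :: "(3 \<Rightarrow> nat list) \<Rightarrow> cell set" where
  "I_neg mu = (\<Union>i. Cyl_neg mu i)"

definition II_bar :: "(3 \<Rightarrow> nat list) \<Rightarrow> 3 \<Rightarrow> cell set" where
  "II_bar mu i = (\<Inter>j\<in>- {i}. Cyl mu j) - Cyl mu i"

definition II :: "(3 \<Rightarrow> nat list) \<Rightarrow> cell set" where
  "II mu = (\<Union>i. II_bar mu i)"

definition III :: "(3 \<Rightarrow> nat list) \<Rightarrow> cell set" where
  "III mu = (\<Inter>i. Cyl mu i)"

text \<open>The quotient space of \<open>complex ^ 3\<close> by the line spanned by \<open>(1, 1, 1)\<close>.\<close>

quotient_type vquot = "complex ^ 3" / "\<lambda>x y. \<exists>c. x - y = c *s vec 1"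
proof (rule equivpI)
  show "reflp (\<lambda>x y :: complex ^ 3. \<exists>c. x - y = c *s vec 1)"
    by (rule reflpI) (rule exI[of _ 0], simp)
  show "symp (\<lambda>x y :: complex ^ 3. \<exists>c. x - y = c *s vec 1)"
  proof (rule sympI)
    fix x y :: "complex ^ 3" assume "\<exists>c. x - y = c *s vec 1"
    then obtain c where "x - y = c *s vec 1" ..
    then have "y - x = (- c) *s vec 1" by (simp add: vec_eq_iff) (metis minus_diff_eq)
    then show "\<exists>c. y - x = c *s vec 1" ..
  qed
  show "transp (\<lambda>x y :: complex ^ 3. \<exists>c. x - y = c *s vec 1)"
  proof (rule transpI)
    fix x y z :: "complex ^ 3"
    assume "\<exists>c. x - y = c *s vec 1" "\<exists>c. y - z = c *s vec 1"
    then obtain c d where "x - y = c *s vec 1" "y - z = d *s vec 1" by blast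
    then have "x - z = (c + d) *s vec 1" by (simp add: vec_eq_iff) (metis diff_add_cancel add_diff_eq)
    then show "\<exists>c. x - z = c *s vec 1" ..
  qed
qed

instantiation vquot :: ab_group_add
begin

lift_definition zero_vquot :: vquot is "0" .

lift_definition plus_vquot :: "vquot \<Rightarrow> vquot \<Rightarrow> vquot" is "(+)"
  by (metis add_diff_add vector_sadd_rdistrib)

lift_definition uminus_vquot :: "vquot \<Rightarrow> vquot" is "uminus"
  by (metis minus_diff_minus vector_sneg_minus1 vector_smult_assoc)

lift_definition minus_vquot :: "vquot \<Rightarrow> vquot \<Rightarrow> vquot" is "(-)"
  by (metis (no_types, opaque_lifting) diff_diff_eq2 diff_diff_add add.commute diff_add_eq vector_ssub_ldistrib vector_sub_rdistrib)

instance
  by standard (transfer, rule exI[of _ 0], simp)+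

end

lift_definition scale_vquot :: "complex \<Rightarrow> vquot \<Rightarrow> vquot" is "(*s)"
  by (metis vector_ssub_ldistrib vector_smult_assoc)

global_interpretation V: vector_space scale_vquot
  by standard (transfer, rule exI[of _ 0], simp add: vector_add_ldistrib vector_sadd_rdistrib)+

definition axis_line :: "3 \<Rightarrow> vquot set" where
  "axis_line i = V.span {abs_vquot (axis i 1)}"

definition is_line :: "vquot set \<Rightarrow> bool" where
  "is_line L \<longleftrightarrow> V.subspace L \<and> V.dim L = 1"

record box_config =
  boxes :: "cell set"
  unlabelled :: "cell set"
  box_label :: "cell \<Rightarrow> vquot set option"

inductive induces :: "(3 \<Rightarrow> nat list) \<Rightarrow> box_config \<Rightarrow> cell \<Rightarrow> vquot set \<Rightarrow> bool"
  for mu :: "3 \<Rightarrow> nat list" and p :: box_config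
where
  "\<lbrakk>n \<in> boxes p; n \<in> Cyl_neg mu j\<rbrakk> \<Longrightarrow> induces mu p n (axis_line j)"
| "\<lbrakk>n \<in> boxes p \<inter> III mu; box_label p n = Some L\<rbrakk> \<Longrightarrow> induces mu p n L"
| "n \<in> unlabelled p \<Longrightarrow> induces mu p n UNIV"

definition induced_span :: "(3 \<Rightarrow> nat list) \<Rightarrow> box_config \<Rightarrow> cell \<Rightarrow> vquot set" where
  "induced_span mu p w = V.span (\<Union>{L. \<exists>n\<in>BN w. induces mu p n L})"

definition labelled_box_config :: "(3 \<Rightarrow> nat list) \<Rightarrow> box_config \<Rightarrow> bool" where
  "labelled_box_config mu p \<longleftrightarrow>
     finite (boxes p) \<and> boxes p \<subseteq> I_neg mu \<union> II mu \<union> III mu \<and>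
     unlabelled p \<subseteq> boxes p \<inter> III mu \<and>
     dom (box_label p) = (boxes p \<inter> III mu) - unlabelled p \<and>
     (\<forall>L\<in>ran (box_label p). is_line L) \<and>
     (\<forall>w\<in>I_neg mu. BN w \<inter> boxes p \<noteq> {} \<longrightarrow> w \<in> boxes p) \<and>
     (\<forall>i. \<forall>w\<in>II_bar mu i.
        (\<exists>n\<in>BN w \<inter> boxes p. \<not> (n \<in> III mu \<and> box_label p n = Some (axis_line i)))
          \<longrightarrow> w \<in> boxes p) \<and>
     (\<forall>w\<in>III mu. let S = induced_span mu p w in
        (S \<noteq> {0} \<longrightarrow> w \<in> boxes p) \<and>
        (V.dim S = 1 \<longrightarrow> box_label p w = Some S \<or> w \<in> unlabelled p) \<and>
        (V.dim S = 2 \<longrightarrow> w \<in> unlabelled p))"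

definition AB_config :: "(3 \<Rightarrow> nat list) \<Rightarrow> cell set \<times> cell set \<Rightarrow> bool" where
  "AB_config mu = (\<lambda>(A, B).
     finite A \<and> finite B \<and> A \<subseteq> I_neg mu \<union> III mu \<and> B \<subseteq> II mu \<union> III mu \<and>
     (\<forall>w\<in>I_neg mu \<union> III mu. BN w \<inter> A \<noteq> {} \<longrightarrow> w \<in> A) \<and>
     (\<forall>w\<in>II mu \<union> III mu. BN w \<inter> B \<noteq> {} \<longrightarrow> w \<in> B))"

definition AB_base :: "(3 \<Rightarrow> nat list) \<Rightarrow> box_config \<Rightarrow> cell set \<times> cell set" where
  "AB_base mu p = (boxes p \<inter> (I_neg mu \<union> III mu), (boxes p \<inter> II mu) \<union> unlabelled p)"

definition AB_push :: "(3 \<Rightarrow> nat list) \<Rightarrow> cell set \<times> cell set \<Rightarrow> cell set \<times> cell set" where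
  "AB_push mu = (\<lambda>(A, B). (A \<union> (III mu \<inter> (B - A)), B - (III mu \<inter> (B - A))))"

definition AB_all :: "(3 \<Rightarrow> nat list) \<Rightarrow> (cell set \<times> cell set) set" where
  "AB_all mu = {q. AB_config mu q \<and> (\<exists>p. labelled_box_config mu p \<and> AB_push mu q = AB_base mu p)}"

definition labelling_set :: "(3 \<Rightarrow> nat list) \<Rightarrow> cell set \<times> cell set \<Rightarrow> cell set" where
  "labelling_set mu = (\<lambda>(A, B).
     (I_neg mu \<inter> A) \<union> (II mu - B) \<union> (III mu \<inter> ((A - B) \<union> (B - A))))"

text \<open>Failure can only occur in the first step of the labelling algorithm, before any label is
  assigned, so success does not depend on the labels chosen in the later steps.\<close>

definition labelling_fails :: "(3 \<Rightarrow> nat list) \<Rightarrow> cell set \<times> cell set \<Rightarrow> bool" where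
  "labelling_fails mu q \<longleftrightarrow>
     (\<exists>C\<in>cell_components (labelling_set mu q). \<exists>i j. i \<noteq> j \<and>
        C \<inter> (Cyl_neg mu i \<union> II_bar mu i) \<noteq> {} \<and> C \<inter> (Cyl_neg mu j \<union> II_bar mu j) \<noteq> {})"

definition labelling_succeeds :: "(3 \<Rightarrow> nat list) \<Rightarrow> cell set \<times> cell set \<Rightarrow> bool" where
  "labelling_succeeds mu q \<longleftrightarrow> \<not> labelling_fails mu q"

end

theory Submission
  imports Defs
begin

text \<open>A labelled box configuration \<open>p\<close> whose base is the push of \<open>(A, B)\<close> has boxes \<open>A \<union> B\<close>, its
  unlabelled boxes are the type III cells of \<open>A \<inter> B\<close> and its labelled boxes the type III cells of
  the symmetric difference, so only the labels are free. Colour a cell of \<open>Cyl_neg mu i\<close> or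
  \<open>II_bar mu i\<close> by the \<open>i\<close>-th axis line and a labelled type III cell by its label. Given that \<open>A\<close>
  and \<open>B\<close> are closed, the axioms of a labelled box configuration say precisely that adjacent cells
  of the labelling set have the same colour. Such a colouring is constant on components, and since
  the three axis lines are distinct it exists exactly when no component meets two differently
  coloured regions.\<close>

section \<open>The quotient space\<close>

lemma exists_third: "\<exists>k::3. k \<noteq> i \<and> k \<noteq> j"
proof -
  have "card {i, j} < CARD(3)" by (simp add: card_insert_if)
  then have "{i, j} \<noteq> UNIV" by (metis less_irrefl)
  then show ?thesis by blast
qed

text \<open>A relation between the two classes lifts to e_i - c e_j = d (1,1,1). Coordinate k,
  different from both i and j, gives d = 0, while coordinate i gives d = 1.\<close>

lemma axis_not_in_axis_line:
  assumes "i \<noteq> j"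
  shows "abs_vquot (axis i 1) \<notin> axis_line j"
proof
  assume "abs_vquot (axis i 1) \<in> axis_line j"
  then obtain c where "abs_vquot (axis i 1) = scale_vquot c (abs_vquot (axis j 1))"
    unfolding axis_line_def V.span_singleton by blast
  then obtain d where d: "axis i 1 - c *s axis j 1 = d *s (vec 1 :: complex^3)"
    unfolding scale_vquot.abs_eq vquot.abs_eq_iff by blast
  obtain k where k: "k \<noteq> i" "k \<noteq> j" using exists_third by blast
  have "(axis i 1 - c *s axis j 1) $ k = d" "(axis i 1 - c *s axis j 1) $ i = d"
    unfolding d by simp_all
  then show False using k assms by (simp add: axis_def)
qed

lemma axis_line_inject [simp]: "axis_line i = axis_line j \<longleftrightarrow> i = j"
proof
  assume "axis_line i = axis_line j"
  moreover have "abs_vquot (axis i 1) \<in> axis_line i"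
    unfolding axis_line_def by (rule V.span_base) simp
  ultimately show "i = j" using axis_not_in_axis_line by metis
qed simp

lemma abs_axis_neq_0: "abs_vquot (axis i 1) \<noteq> 0"
proof -
  obtain j where "j \<noteq> i" using exists_third by blast
  then show ?thesis
    using axis_not_in_axis_line[of i j] V.span_zero unfolding axis_line_def by metis
qed

lemma axis_lines_span: "V.span {abs_vquot (axis 1 1), abs_vquot (axis 2 1)} = UNIV"
proof -
  have "x \<in> V.span {abs_vquot (axis 1 1), abs_vquot (axis 2 1)}" for x
  proof (induction x rule: vquot.abs_induct)
    fix y :: "complex^3"
    \<comment> \<open>Modulo (1,1,1) the third coordinate can be cleared, which leaves a combination
      of the first two basis vectors.\<close>
    have "y - ((y $ 1 - y $ 3) *s axis 1 1 + (y $ 2 - y $ 3) *s axis 2 1) = (y $ 3) *s vec 1"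
      by (simp add: vec_eq_iff forall_3 axis_def)
    then have "abs_vquot y = scale_vquot (y $ 1 - y $ 3) (abs_vquot (axis 1 1))
        + scale_vquot (y $ 2 - y $ 3) (abs_vquot (axis 2 1))"
      unfolding scale_vquot.abs_eq plus_vquot.abs_eq vquot.abs_eq_iff by blast
    then show "abs_vquot y \<in> V.span {abs_vquot (axis 1 1), abs_vquot (axis 2 1)}"
      by (simp add: V.span_add V.span_scale V.span_base)
  qed
  then show ?thesis by blast
qed

interpretation V: finite_dimensional_vector_space scale_vquot
  "{abs_vquot (axis 1 1), abs_vquot (axis 2 1)}"
proof
  have "abs_vquot (axis 1 1) \<notin> V.span {abs_vquot (axis 2 1)}"
    using axis_not_in_axis_line[of 1 2] by (simp add: axis_line_def)
  then show "V.independent {abs_vquot (axis 1 1), abs_vquot (axis 2 1)}"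
    by (simp add: V.independent_insert abs_axis_neq_0 V.span_base)
qed (simp_all add: axis_lines_span)

lemma dim_le_2: "V.dim S \<le> 2"
proof -
  have "V.dim S \<le> card {abs_vquot (axis 1 1), abs_vquot (axis 2 1)}"
    by (rule V.dim_le_card) (simp_all add: axis_lines_span)
  also have "\<dots> \<le> 2" by (simp add: card_insert_if)
  finally show ?thesis .
qed

lemma is_line_axis_line: "is_line (axis_line i)"
  unfolding is_line_def axis_line_def
  by (simp add: V.dim_eq_card_independent abs_axis_neq_0)

text \<open>The space has dimension 2, so nothing lies strictly between a line and dimension 2.
  Hence a type III cell that is not unlabelled must carry every line induced at it.\<close>

lemma line_subset_cases:
  assumes "is_line L" "L \<subseteq> S" "V.subspace S"
  shows "V.dim S = 2 \<or> V.dim S = 1 \<and> S = L"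
proof -
  have "V.dim L \<le> V.dim S" using assms V.dim_subset by blast
  then show ?thesis
    using assms dim_le_2[of S] V.subspace_dim_equal[of L S] unfolding is_line_def
    by (cases "V.dim S \<le> 1") auto
qed

section \<open>Geometry of the cylinders\<close>

lemma diagram_down_closed:
  assumes "is_partition la" "(u, v) \<in> diagram la" "0 \<le> u'" "u' \<le> u" "0 \<le> v'" "v' \<le> v"
  shows "(u', v') \<in> diagram la"
proof -
  \<comment> \<open>Sortedness compares only distinct indices, so equal rows are split off; past the
    end of the list \<open>part\<close> is 0.\<close>
  have "part la (nat v + 1) \<le> part la (nat v' + 1)"
    using assms sorted_wrt_nth_less[of "(\<ge>)" la "nat v'" "nat v"]
    by (cases "v = v'") (auto simp: part_def is_partition_def)
  then show ?thesis using assms by (auto simp: diagram_def)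
qed

text \<open>Indices in the type \<open>3\<close> wrap around, so one formula covers the three cylinders.\<close>

lemma Cyl_iff: "w \<in> Cyl mu i \<longleftrightarrow> (w $ (i + 1), w $ (i + 2)) \<in> diagram (mu i)"
proof -
  have w: "w = vector [w $ 1, w $ 2, w $ 3]"
    by (simp add: vec_eq_iff forall_3 vector_3)
  \<comment> \<open>These numerals arise from \<open>i + 1\<close> and \<open>i + 2\<close> at
    indices 2 and 3.\<close>
  have wrap: "(4::3) = 1" "(5::3) = 2"
    by simp_all
  consider "i = 1" | "i = 2" | "i = 3" using exhaust_3 by blast
  then show ?thesis
  proof cases
    case 1
    then show ?thesis using w by (auto simp: Cyl_def)
  next
    case 2
    then have "w \<in> Cyl mu i \<longleftrightarrow> (w $ 3, w $ 1) \<in> diagram (mu 2)"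
      using w by (auto simp: Cyl_def)
    then show ?thesis using 2 by (simp add: wrap)
  next
    case 3
    then have "w \<in> Cyl mu i \<longleftrightarrow> (w $ 1, w $ 2) \<in> diagram (mu 3)"
      using w by (auto simp: Cyl_def)
    then show ?thesis using 3 by (simp add: wrap)
  qed
qed

lemma index_cases: "k = i \<or> k = i + 1 \<or> k = i + 2" for i k :: 3
  using exhaust_3[of i] exhaust_3[of k] by auto

lemma Cyl_nonneg:
  assumes "w \<in> Cyl mu i" "k \<noteq> i"
  shows "0 \<le> w $ k"
  using assms index_cases[of k i] by (auto simp: Cyl_iff diagram_def)

lemma Cyl_add_axis: "w + axis i 1 \<in> Cyl mu i \<longleftrightarrow> w \<in> Cyl mu i"
  by (simp add: Cyl_iff axis_def)

lemma Cyl_down_closed: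
  assumes "is_partition (mu i)" "w \<in> Cyl mu i" "\<And>k. 0 \<le> n $ k" "\<And>k. n $ k \<le> w $ k"
  shows "n \<in> Cyl mu i"
  using assms diagram_down_closed unfolding Cyl_iff by blast

text \<open>Only the coordinate along the axis of a cylinder can be negative.\<close>

lemma Cyl_neg_iff: "w \<in> Cyl_neg mu i \<longleftrightarrow> w \<in> Cyl mu i \<and> w $ i < 0"
  unfolding Cyl_neg_def using Cyl_nonneg[of w mu i] by (auto simp: not_le) (metis not_le)

lemma III_nonneg:
  assumes "w \<in> III mu"
  shows "0 \<le> w $ k"
proof -
  obtain i where "i \<noteq> k" using exists_third by blast
  then show ?thesis using assms Cyl_nonneg[of w mu i k] by (auto simp: III_def)
qed

lemma II_bar_nonneg:
  assumes "w \<in> II_bar mu j"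
  shows "0 \<le> w $ k"
proof -
  \<comment> \<open>The cell lies in the cylinder of index i, whose axis is not direction k.\<close>
  obtain i where "i \<noteq> k" "i \<noteq> j" using exists_third by blast
  then show ?thesis using assms Cyl_nonneg[of w mu i k] by (auto simp: II_bar_def)
qed

text \<open>These are the cells whose component receives the label i in step 2 of the
  algorithm.\<close>

definition region :: "(3 \<Rightarrow> nat list) \<Rightarrow> 3 \<Rightarrow> cell set" where
  "region mu i = Cyl_neg mu i \<union> II_bar mu i"

lemma II_bar_disjoint_Cyl_neg: "w \<in> II_bar mu i \<Longrightarrow> w \<notin> Cyl_neg mu j"
  using II_bar_nonneg by (auto simp: Cyl_neg_iff not_less)

lemma III_disjoint_region: "w \<in> III mu \<Longrightarrow> w \<notin> region mu i"
  using III_nonneg by (auto simp: region_def Cyl_neg_iff II_bar_def III_def not_less)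

text \<open>A cell of \<open>Cyl_neg\<close> has exactly one negative coordinate, which is its
  index; a cell of \<open>II_bar\<close> misses exactly one cylinder.\<close>

lemma region_unique:
  assumes "w \<in> region mu i" "w \<in> region mu j"
  shows "i = j"
proof (cases "w \<in> II_bar mu i")
  case True
  then have "w \<in> II_bar mu j"
    using assms II_bar_disjoint_Cyl_neg by (auto simp: region_def)
  with True show ?thesis by (auto simp: II_bar_def)
next
  case False
  then have "w \<in> Cyl_neg mu i" "w \<in> Cyl_neg mu j"
    using assms II_bar_disjoint_Cyl_neg by (auto simp: region_def)
  then show ?thesis using Cyl_nonneg[of w mu i j] by (auto simp: Cyl_neg_iff)
qed

lemma types_disjoint:
  "I_neg mu \<inter> II mu = {}" "I_neg mu \<inter> III mu = {}" "II mu \<inter> III mu = {}"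
  using II_bar_disjoint_Cyl_neg III_disjoint_region
  by (auto simp: I_neg_def II_def region_def; blast)+

lemma add_axis_nth: "(n + axis k 1) $ j = n $ j + (if j = k then 1 else 0)"
  for n :: cell
  by (simp add: axis_def)

section \<open>Forward unit steps between the types of cells\<close>

lemma Cyl_neg_add_axis:
  assumes "n + axis k 1 \<in> Cyl_neg mu i"
  shows "n $ i < 0"
  using assms add_axis_nth[of n k i] by (auto simp: Cyl_neg_iff split: if_splits)

lemma Cyl_neg_step:
  assumes "n \<in> Cyl_neg mu i" "n + axis k 1 \<in> Cyl_neg mu j"
  shows "i = j"
  using assms Cyl_neg_add_axis[OF assms(2)] Cyl_nonneg[of n mu i j] by (auto simp: Cyl_neg_iff)

text \<open>With equal indices the step would have to raise the negative coordinate i, so it would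
  run along the axis and stay inside \<open>Cyl mu i\<close>, which \<open>II_bar mu i\<close>
  avoids.\<close>

lemma Cyl_neg_step_II_bar:
  assumes "n \<in> Cyl_neg mu i" "n + axis k 1 \<in> II_bar mu j"
  shows "i \<noteq> j"
proof
  assume "i = j"
  have "0 \<le> (n + axis k 1) $ i" using assms(2) by (rule II_bar_nonneg)
  then have "k = i"
    using assms(1) unfolding add_axis_nth by (auto simp: Cyl_neg_iff split: if_splits)
  then show False
    using assms \<open>i = j\<close> by (auto simp: Cyl_neg_iff II_bar_def Cyl_add_axis)
qed

text \<open>Among nonnegative cells each cylinder is closed downwards, so a forward step cannot
  enter the one cylinder that the starting cell misses.\<close>

lemma II_bar_step:
  assumes "\<And>l. is_partition (mu l)" "n \<in> II_bar mu i" "n + axis k 1 \<in> II_bar mu j"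
  shows "i = j"
proof (rule ccontr)
  assume "i \<noteq> j"
  then have "n + axis k 1 \<in> Cyl mu i" using assms(3) by (auto simp: II_bar_def)
  then have "n \<in> Cyl mu i"
    by (rule Cyl_down_closed[rotated])
      (use assms II_bar_nonneg in \<open>auto simp: axis_def\<close>)
  then show False using assms(2) by (auto simp: II_bar_def)
qed

lemma II_bar_step_III:
  assumes "\<And>l. is_partition (mu l)" "n \<in> II_bar mu i"
  shows "n + axis k 1 \<notin> III mu"
proof
  assume "n + axis k 1 \<in> III mu"
  then have "n + axis k 1 \<in> Cyl mu i" by (auto simp: III_def)
  then have "n \<in> Cyl mu i"
    by (rule Cyl_down_closed[rotated])
      (use assms II_bar_nonneg in \<open>auto simp: axis_def\<close>)
  then show False using assms(2) by (auto simp: II_bar_def)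
qed

lemma BN_iff: "n \<in> BN w \<longleftrightarrow> (\<exists>k. w = n + axis k 1)"
  by (auto simp: BN_def algebra_simps)

section \<open>Colourings of the labelling set\<close>

definition adjacency :: "cell set \<Rightarrow> (cell \<times> cell) set" where
  "adjacency S = {(x, y). x \<in> S \<and> y \<in> S \<and> adjacent x y}"

lemma adjacent_sym: "adjacent x y \<Longrightarrow> adjacent y x"
  unfolding adjacent_def by (metis add_diff_cancel_right' diff_add_cancel)

lemma sym_adjacency: "sym (adjacency S)"
  by (auto simp: sym_def adjacency_def adjacent_sym)

text \<open>Adjacency is symmetric, so components are the classes of an equivalence relation, and
  sharing a component amounts to being joined by a path.\<close>

lemma labelling_fails_iff:
  "labelling_fails mu q \<longleftrightarrow>
     (\<exists>x\<in>labelling_set mu q. \<exists>y\<in>labelling_set mu q. \<exists>i j. i \<noteq> j \<and>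
        (x, y) \<in> (adjacency (labelling_set mu q))\<^sup>* \<and> x \<in> region mu i \<and> y \<in> region mu j)"
  (is "_ \<longleftrightarrow> ?R")
proof -
  define S where "S = labelling_set mu q"
  define E where "E = {(x, y). x \<in> S \<and> y \<in> S \<and> (x, y) \<in> (adjacency S)\<^sup>*}"
  have comps: "cell_components S = S // E"
    by (simp add: cell_components_def E_def adjacency_def)
  have "equiv S E"
  proof (rule equivI)
    show "E \<subseteq> S \<times> S" "refl_on S E" by (auto simp: E_def refl_on_def)
    show "sym E" using sym_rtrancl[OF sym_adjacency[of S]] by (auto simp: E_def sym_def)
    show "trans E" by (auto simp: E_def trans_def intro: rtrancl_trans)
  qed
  have fails: "labelling_fails mu q \<longleftrightarrow>
      (\<exists>C\<in>S // E. \<exists>i j. i \<noteq> j \<and> C \<inter> region mu i \<noteq> {} \<and> C \<inter> region mu j \<noteq> {})"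
    by (simp add: labelling_fails_def S_def[symmetric] comps region_def)
  show ?thesis
  proof
    assume "labelling_fails mu q"
    then obtain C i j x y where *: "C \<in> S // E" "i \<noteq> j" "x \<in> C" "x \<in> region mu i"
      "y \<in> C" "y \<in> region mu j"
      unfolding fails by blast
    have "(x, y) \<in> E" using quotient_eq_iff[OF \<open>equiv S E\<close> *(1) *(1) *(3) *(5)] by simp
    then show ?R using * by (auto simp: E_def S_def)
  next
    assume ?R
    then obtain x y i j where *: "(x, y) \<in> E" "x \<in> S" "i \<noteq> j" "x \<in> region mu i" "y \<in> region mu j"
      unfolding S_def[symmetric] by (auto simp: E_def)
    have "E `` {x} \<in> S // E" "x \<in> E `` {x}" "y \<in> E `` {x}"
      using * by (blast intro: quotientI, auto simp: E_def)
    then show "labelling_fails mu q" unfolding fails using * by blast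
  qed
qed

text \<open>Only forward steps appear, to match \<open>BN\<close> in the configuration axioms;
  equality of colours is symmetric, so backward steps are covered.\<close>

definition colouring :: "(3 \<Rightarrow> nat list) \<Rightarrow> cell set \<Rightarrow> (cell \<Rightarrow> vquot set) \<Rightarrow> bool" where
  "colouring mu S c \<longleftrightarrow>
     (\<forall>w\<in>S. is_line (c w)) \<and>
     (\<forall>w\<in>S. \<forall>k. w + axis k 1 \<in> S \<longrightarrow> c w = c (w + axis k 1)) \<and>
     (\<forall>i. \<forall>w\<in>S \<inter> region mu i. c w = axis_line i)"

text \<open>If the algorithm succeeds, each component is coloured by the unique index it meets.
  Conversely a colouring is constant along paths, and distinct axis lines cannot be joined.\<close>

lemma labelling_succeeds_iff_colouring:
  "labelling_succeeds mu q \<longleftrightarrow> (\<exists>c. colouring mu (labelling_set mu q) c)"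
proof -
  define S where "S = labelling_set mu q"
  show ?thesis
  proof
    assume succ: "labelling_succeeds mu q"
    \<comment> \<open>\<open>hit w i\<close> says that the component of \<open>w\<close> meets
      region i. A component meeting no region gets the arbitrary index picked by
      \<open>SOME\<close>, which is the same on the whole component because the predicates
      \<open>hit w\<close> agree.\<close>
    define hit where "hit w i \<longleftrightarrow> (\<exists>y\<in>S \<inter> region mu i. (w, y) \<in> (adjacency S)\<^sup>*)" for w i
    define c where "c w = axis_line (SOME i. hit w i)" for w
    have "hit w = hit (w + axis k 1)" if "w \<in> S" "w + axis k 1 \<in> S" for w k
    proof -
      have "(w, w + axis k 1) \<in> adjacency S" using that by (auto simp: adjacency_def adjacent_def)
      moreover from this have "(w + axis k 1, w) \<in> adjacency S"
        using sym_adjacency by (auto dest: symD)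
      ultimately show ?thesis
        unfolding hit_def by (blast intro: converse_rtrancl_into_rtrancl)
    qed
    moreover have "(SOME j. hit w j) = i" if "w \<in> S \<inter> region mu i" for w i
    proof -
      have "hit w i" using that unfolding hit_def by blast
      moreover have "j = i" if "hit w j" for j
        using succ that \<open>w \<in> S \<inter> region mu i\<close>
        unfolding labelling_succeeds_def labelling_fails_iff S_def[symmetric] hit_def by (metis IntE)
      ultimately show "(SOME j. hit w j) = i" by blast
    qed
    ultimately have "colouring mu S c"
      unfolding colouring_def c_def by (auto simp: is_line_axis_line)
    then show "\<exists>c. colouring mu (labelling_set mu q) c" unfolding S_def by blast
  next
    assume "\<exists>c. colouring mu (labelling_set mu q) c"
    then obtain c where c: "colouring mu S c" unfolding S_def by blast
    have step: "c x = c y" if "(x, y) \<in> adjacency S" for x y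
    proof -
      obtain k where "y = x + axis k 1 \<or> x = y + axis k 1"
        using \<open>(x, y) \<in> adjacency S\<close> by (auto simp: adjacency_def adjacent_def algebra_simps)
      then show ?thesis using c that by (auto simp: colouring_def adjacency_def)
    qed
    have "c x = c y" if "(x, y) \<in> (adjacency S)\<^sup>*" for x y
      using that by induction (auto dest: step)
    then show "labelling_succeeds mu q"
      using c unfolding labelling_succeeds_def labelling_fails_iff S_def[symmetric] colouring_def
      by (metis IntI axis_line_inject)
  qed
qed

section \<open>Colourings and labelled box configurations\<close>

lemma colouring_if_labelled_box_config:
  assumes part: "\<And>i. is_partition (mu i)"
    and AB: "AB_config mu (A, B)"
    and p: "labelled_box_config mu p"
    and base: "AB_push mu (A, B) = AB_base mu p"
  shows "\<exists>c. colouring mu (labelling_set mu (A, B)) c"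
proof -
  define S where "S = labelling_set mu (A, B)"
  have S_eq: "S = (I_neg mu \<inter> A) \<union> (II mu - B) \<union> (III mu \<inter> ((A - B) \<union> (B - A)))"
    by (simp add: S_def labelling_set_def)
  have sub: "A \<subseteq> I_neg mu \<union> III mu" "B \<subseteq> II mu \<union> III mu"
    using AB by (auto simp: AB_config_def)
  have p_sub: "boxes p \<subseteq> I_neg mu \<union> II mu \<union> III mu" "unlabelled p \<subseteq> boxes p \<inter> III mu"
    and dom: "dom (box_label p) = (boxes p \<inter> III mu) - unlabelled p"
    and line: "\<forall>L\<in>ran (box_label p). is_line L"
    and "\<forall>i. \<forall>w\<in>II_bar mu i.
        (\<exists>n\<in>BN w \<inter> boxes p. \<not> (n \<in> III mu \<and> box_label p n = Some (axis_line i)))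
          \<longrightarrow> w \<in> boxes p"
    and III_rule: "\<forall>w\<in>III mu.
        (induced_span mu p w \<noteq> {0} \<longrightarrow> w \<in> boxes p) \<and>
        (V.dim (induced_span mu p w) = 1 \<longrightarrow>
          box_label p w = Some (induced_span mu p w) \<or> w \<in> unlabelled p) \<and>
        (V.dim (induced_span mu p w) = 2 \<longrightarrow> w \<in> unlabelled p)"
    using p unfolding labelled_box_config_def Let_def by - (elim conjE, assumption)+
  then have II_rule: "n \<in> III mu \<and> box_label p n = Some (axis_line i)"
    if "w \<in> II_bar mu i" "n \<in> BN w \<inter> boxes p" "w \<notin> boxes p" for i w n
    using that by blast
  have base': "A \<union> (III mu \<inter> (B - A)) = boxes p \<inter> (I_neg mu \<union> III mu)"
    "B - (III mu \<inter> (B - A)) = (boxes p \<inter> II mu) \<union> unlabelled p"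
    using base by (auto simp: AB_push_def AB_base_def)
  \<comment> \<open>The types are disjoint, so intersecting the second part of the base with
    \<open>III mu\<close> or \<open>II mu\<close> separates unlabelled boxes from type II
    boxes.\<close>
  have "unlabelled p = III mu \<inter> ((boxes p \<inter> II mu) \<union> unlabelled p)"
    using p_sub(2) types_disjoint(3)[of mu] by blast
  also have "\<dots> = III mu \<inter> A \<inter> B"
    unfolding base'(2)[symmetric] by blast
  finally have unlab: "unlabelled p = III mu \<inter> A \<inter> B" .
  have "boxes p \<inter> II mu = II mu \<inter> ((boxes p \<inter> II mu) \<union> unlabelled p)"
    using p_sub(2) types_disjoint(3)[of mu] by blast
  also have "\<dots> = II mu \<inter> B"
    unfolding base'(2)[symmetric] using types_disjoint(3)[of mu] by blast
  finally have boxes_II: "boxes p \<inter> II mu = II mu \<inter> B" .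
  have "boxes p = (boxes p \<inter> (I_neg mu \<union> III mu)) \<union> (boxes p \<inter> II mu)"
    using p_sub(1) by blast
  also have "\<dots> = A \<union> B"
    unfolding base'(1)[symmetric] boxes_II using sub(2) by blast
  finally have boxes: "boxes p = A \<union> B" .
  have label_ex: "\<exists>L. box_label p w = Some L \<and> is_line L" if "w \<in> S \<inter> III mu" for w
  proof -
    have "w \<in> dom (box_label p)"
      using that types_disjoint[of mu] unfolding dom boxes unlab S_eq by blast
    then show ?thesis using line by (auto intro: ranI)
  qed
  \<comment> \<open>The cell \<open>w\<close> is not unlabelled, so its induced span is not
    two-dimensional and therefore equals any line \<open>L\<close> it contains.\<close>
  have induced: "box_label p w = Some L"
    if w: "w \<in> S \<inter> III mu" "n \<in> BN w" and L: "induces mu p n L" "is_line L" for w n L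
  proof -
    have "L \<subseteq> induced_span mu p w"
      unfolding induced_span_def using w L by (blast intro: V.span_base)
    moreover have "V.subspace (induced_span mu p w)"
      unfolding induced_span_def by simp
    moreover have "w \<notin> unlabelled p"
      using w types_disjoint[of mu] unfolding unlab S_eq by blast
    ultimately show ?thesis
      using line_subset_cases[OF L(2), of "induced_span mu p w"] bspec[OF III_rule, of w] w
      by auto
  qed
  define c where
    "c w = (if w \<in> III mu then the (box_label p w) else axis_line (THE i. w \<in> region mu i))" for w
  have c_region: "c w = axis_line i" if "w \<in> region mu i" for w i
  proof -
    have "(THE j. w \<in> region mu j) = i" using that region_unique by blast
    then show ?thesis using that III_disjoint_region by (auto simp: c_def)
  qed
  \<comment> \<open>In the labelling set, cells of \<open>Cyl_neg\<close> are boxes, whereas type II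
    cells are the missing boxes.\<close>
  have S_cases: "w \<in> III mu \<or> (\<exists>i. w \<in> Cyl_neg mu i \<and> w \<in> boxes p)
      \<or> (\<exists>i. w \<in> II_bar mu i \<and> w \<notin> boxes p)" if "w \<in> S" for w
  proof -
    have "w \<notin> A" if "w \<in> II mu" using that sub(1) types_disjoint[of mu] by blast
    then show ?thesis using \<open>w \<in> S\<close> by (auto simp: S_eq boxes I_neg_def II_def)
  qed
  have boxes_III: "w \<in> boxes p" if "w \<in> S \<inter> III mu" for w
    using that types_disjoint[of mu] unfolding S_eq boxes by blast
  have "c n = c (n + axis k 1)" if nS: "n \<in> S" and wS: "n + axis k 1 \<in> S" for n k
  proof -
    define w where "w = n + axis k 1"
    have BN: "n \<in> BN w" by (auto simp: BN_iff w_def)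
    have no_neg: "w \<notin> Cyl_neg mu j" if "\<And>l. 0 \<le> n $ l" for j
      using Cyl_neg_add_axis[of n k mu j] that[of j] by (auto simp: w_def)
    consider (neg) i where "n \<in> Cyl_neg mu i" "n \<in> boxes p" | (II) i where "n \<in> II_bar mu i"
      | (III) "n \<in> III mu"
      using S_cases[OF nS] by blast
    then have "c n = c w"
    proof cases
      case neg
      then have cn: "c n = axis_line i" using c_region[of n i] by (simp add: region_def)
      have "w \<in> III mu \<Longrightarrow> box_label p w = Some (axis_line i)"
        by (rule induced[OF _ BN])
          (use neg wS in \<open>auto simp: w_def is_line_axis_line intro: induces.intros\<close>)
      then have "w \<in> III mu \<Longrightarrow> c w = axis_line i" by (simp add: c_def)
      moreover have "c w = axis_line i" if "w \<in> Cyl_neg mu j" for j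
        using Cyl_neg_step[of n mu i k j] neg that c_region[of w j] by (simp add: w_def region_def)
      \<comment> \<open>A box of \<open>Cyl_neg\<close> is not of type III, so the exception in the
        type II axiom does not apply and \<open>w\<close> would be a box.\<close>
      moreover have False if "w \<in> II_bar mu j" "w \<notin> boxes p" for j
        using II_rule[OF that(1) _ that(2), of n] BN neg III_disjoint_region[of n mu i]
        by (auto simp: region_def)
      ultimately show ?thesis
        unfolding cn using S_cases[OF wS[folded w_def]] by metis
    next
      case II
      then have cn: "c n = axis_line i" using c_region[of n i] by (simp add: region_def)
      have "w \<notin> III mu" using II_bar_step_III[OF part II] by (simp add: w_def)
      moreover have "w \<notin> Cyl_neg mu j" for j
        using no_neg II_bar_nonneg[OF II] by blast
      ultimately obtain j where "w \<in> II_bar mu j" using S_cases[OF wS[folded w_def]] by blast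
      moreover from this have "i = j" using II_bar_step[OF part II] by (simp add: w_def)
      ultimately show ?thesis using cn c_region[of w j] by (simp add: region_def)
    next
      case III
      then obtain L where L: "box_label p n = Some L" "is_line L" using label_ex nS by blast
      then have cn: "c n = L" using III by (simp add: c_def)
      have nb: "n \<in> boxes p" using boxes_III nS III by blast
      have "w \<notin> Cyl_neg mu j" for j
        using no_neg III_nonneg[OF III] by blast
      then consider (a) "w \<in> III mu" | (b) j where "w \<in> II_bar mu j" "w \<notin> boxes p"
        using S_cases[OF wS[folded w_def]] by blast
      then show ?thesis
      proof cases
        case a
        have "box_label p w = Some L"
          by (rule induced[OF _ BN]) (use a wS nb III L in \<open>auto simp: w_def intro: induces.intros\<close>)
        then show ?thesis using cn a by (simp add: c_def)
      next
        case b
        \<comment> \<open>Since \<open>w\<close> is not a box, its neighbour \<open>n\<close> must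
          fall under the exception in the type II axiom, which fixes its label.\<close>
        have "L = axis_line j" using II_rule[OF b(1) _ b(2), of n] BN nb L by auto
        then show ?thesis using cn c_region[of w j] b by (simp add: region_def)
      qed
    qed
    then show ?thesis by (simp add: w_def)
  qed
  moreover have "is_line (c w)" if "w \<in> S" for w
  proof (cases "w \<in> III mu")
    case True
    then show ?thesis using label_ex that by (fastforce simp: c_def)
  next
    case False
    then obtain i where "w \<in> region mu i" using S_cases[OF \<open>w \<in> S\<close>] by (auto simp: region_def)
    then show ?thesis using c_region is_line_axis_line by metis
  qed
  ultimately have "colouring mu S c" using c_region by (auto simp: colouring_def)
  then show ?thesis unfolding S_def by blast
qed

text \<open>The colours serve as labels. The axiom on \<open>I_neg\<close> follows from closure of
  \<open>A\<close>; the other two combine closure of \<open>A\<close> and \<open>B\<close> with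
  equality of neighbouring colours.\<close>

lemma labelled_box_config_if_colouring:
  assumes AB: "AB_config mu (A, B)"
    and c: "colouring mu (labelling_set mu (A, B)) c"
  shows "\<exists>p. labelled_box_config mu p \<and> AB_push mu (A, B) = AB_base mu p"
proof -
  define S where "S = labelling_set mu (A, B)"
  have S_eq: "S = (I_neg mu \<inter> A) \<union> (II mu - B) \<union> (III mu \<inter> ((A - B) \<union> (B - A)))"
    by (simp add: S_def labelling_set_def)
  have line: "\<And>w. w \<in> S \<Longrightarrow> is_line (c w)"
    and step: "\<And>w k. \<lbrakk>w \<in> S; w + axis k 1 \<in> S\<rbrakk> \<Longrightarrow> c w = c (w + axis k 1)"
    and reg: "\<And>w i. \<lbrakk>w \<in> S; w \<in> region mu i\<rbrakk> \<Longrightarrow> c w = axis_line i"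
    using c unfolding S_def[symmetric] colouring_def by blast+
  have BN_step: "c n = c w" if "n \<in> BN w" "n \<in> S" "w \<in> S" for n w
    using that step by (auto simp: BN_iff)
  have fin: "finite A" "finite B" and sub: "A \<subseteq> I_neg mu \<union> III mu" "B \<subseteq> II mu \<union> III mu"
    and A_closed: "\<And>w n. \<lbrakk>w \<in> I_neg mu \<union> III mu; n \<in> BN w; n \<in> A\<rbrakk> \<Longrightarrow> w \<in> A"
    and B_closed: "\<And>w n. \<lbrakk>w \<in> II mu \<union> III mu; n \<in> BN w; n \<in> B\<rbrakk> \<Longrightarrow> w \<in> B"
    using AB unfolding AB_config_def by blast+
  define D where "D = III mu \<inter> ((A - B) \<union> (B - A))"
  define p where "p = \<lparr>boxes = A \<union> B, unlabelled = III mu \<inter> A \<inter> B,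
    box_label = (\<lambda>w. if w \<in> D then Some (c w) else None)\<rparr>"
  have p_simps: "boxes p = A \<union> B" "unlabelled p = III mu \<inter> A \<inter> B"
    "box_label p w = (if w \<in> D then Some (c w) else None)" for w
    by (simp_all add: p_def)
  have "D \<subseteq> S" by (auto simp: D_def S_eq)
  have I_rule: "w \<in> A \<union> B" if w: "w \<in> I_neg mu" and n: "n \<in> BN w" "n \<in> A \<union> B" for w n
  proof -
    obtain i where "w \<in> Cyl_neg mu i" using w by (auto simp: I_neg_def)
    then have "n $ i < 0" using Cyl_neg_add_axis \<open>n \<in> BN w\<close> by (auto simp: BN_iff)
    \<comment> \<open>All cells of \<open>B\<close> have nonnegative coordinates.\<close>
    then have "n \<notin> B" using sub II_bar_nonneg III_nonneg by (fastforce simp: II_def not_le[symmetric])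
    then show ?thesis using w n A_closed by blast
  qed
  have II_rule: "w \<in> A \<union> B"
    if w: "w \<in> II_bar mu i" and n: "n \<in> BN w" "n \<in> A \<union> B"
      and lab: "\<not> (n \<in> III mu \<and> box_label p n = Some (axis_line i))" for i w n
  proof (rule ccontr)
    assume w_box: "w \<notin> A \<union> B"
    have "w \<in> II mu" using w by (auto simp: II_def)
    then have "w \<in> S" "n \<notin> B" using w_box n B_closed by (auto simp: S_eq)
    then have "n \<in> A" "n \<in> S" using n sub by (auto simp: S_eq)
    then have cn: "c n = axis_line i"
      using BN_step[OF n(1) _ \<open>w \<in> S\<close>] reg[OF \<open>w \<in> S\<close>, of i] w by (simp add: region_def)
    have "n \<notin> III mu"
      using lab cn \<open>n \<in> A\<close> \<open>n \<notin> B\<close> by (auto simp: p_simps D_def)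
    then obtain j where j: "n \<in> Cyl_neg mu j" using \<open>n \<in> A\<close> sub by (auto simp: I_neg_def)
    then have "i = j" using reg[OF \<open>n \<in> S\<close>, of j] cn by (simp add: region_def)
    \<comment> \<open>Equal colours force equal indices, but a forward step from
      \<open>Cyl_neg\<close> into \<open>II_bar\<close> changes the index.\<close>
    then show False using Cyl_neg_step_II_bar[OF j] n w by (auto simp: BN_iff)
  qed
  have induced: "w \<in> A \<union> B \<and> (w \<in> D \<longrightarrow> L = c w)"
    if w: "w \<in> III mu" and n: "n \<in> BN w" and "induces mu p n L" for w n L
    using \<open>induces mu p n L\<close>
  proof cases
    case (1 j)
    then have "n \<in> I_neg mu" by (auto simp: I_neg_def)
    then have "n \<in> A" using 1 sub types_disjoint[of mu] by (auto simp: p_simps)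
    then have "n \<in> S" using \<open>n \<in> I_neg mu\<close> by (auto simp: S_eq)
    then have "c n = axis_line j" using reg[of n j] 1 by (simp add: region_def)
    then show ?thesis
      using A_closed[of w n] w n \<open>n \<in> A\<close> BN_step[OF n \<open>n \<in> S\<close>] \<open>D \<subseteq> S\<close> 1(1) by auto
  next
    case 2
    then have "n \<in> D" "L = c n" by (auto simp: p_simps split: if_splits)
    moreover have "w \<in> A \<union> B"
      using 2 A_closed[of w n] B_closed[of w n] w n by (auto simp: p_simps)
    ultimately show ?thesis using BN_step[OF n] \<open>D \<subseteq> S\<close> by auto
  next
    case 3
    \<comment> \<open>An unlabelled box lies in both sets, so closure puts \<open>w\<close> in both;
      then \<open>w\<close> is outside \<open>D\<close> and the claim about labels is
      vacuous.\<close>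
    then have "w \<in> A \<inter> B"
      using A_closed[of w n] B_closed[of w n] w n by (auto simp: p_simps)
    then show ?thesis by (auto simp: D_def)
  qed
  have III_rule: "(V.dim T = 1 \<longrightarrow> box_label p w = Some T \<or> w \<in> unlabelled p) \<and>
      (V.dim T = 2 \<longrightarrow> w \<in> unlabelled p) \<and> (T \<noteq> {0} \<longrightarrow> w \<in> boxes p)"
    if w: "w \<in> III mu" and T: "T = induced_span mu p w" for w T
  proof (cases "\<exists>n\<in>BN w. \<exists>L. induces mu p n L")
    case False
    then have "T = {0}" unfolding T induced_span_def by simp
    then show ?thesis by simp
  next
    case True
    then have box: "w \<in> A \<union> B" using induced w by blast
    show ?thesis
    proof (cases "w \<in> D")
      case False
      \<comment> \<open>A type III box outside \<open>D\<close> lies in both \<open>A\<close> and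
        \<open>B\<close>, hence is unlabelled, which satisfies every clause.\<close>
      then show ?thesis using w box by (auto simp: p_simps D_def)
    next
      case inD: True
      \<comment> \<open>All neighbours induce the same line, so the span is the line
        \<open>c w\<close> and has dimension 1.\<close>
      then have "{L. \<exists>n\<in>BN w. induces mu p n L} = {c w}" using True induced w by blast
      moreover have "is_line (c w)" using line inD \<open>D \<subseteq> S\<close> by blast
      ultimately have "T = c w" "V.dim T = 1"
        unfolding T induced_span_def is_line_def by simp_all
      then show ?thesis using inD box by (simp add: p_simps)
    qed
  qed
  have "labelled_box_config mu p"
    unfolding labelled_box_config_def Let_def
  proof (intro conjI ballI allI impI)
    show "finite (boxes p)" using fin by (simp add: p_simps)
    show "boxes p \<subseteq> I_neg mu \<union> II mu \<union> III mu" using sub by (auto simp: p_simps)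
    show "unlabelled p \<subseteq> boxes p \<inter> III mu" by (auto simp: p_simps)
    show "dom (box_label p) = boxes p \<inter> III mu - unlabelled p"
      by (auto simp: p_simps D_def dom_def)
    show "is_line L" if "L \<in> ran (box_label p)" for L
      using that line \<open>D \<subseteq> S\<close> by (auto simp: ran_def p_simps split: if_splits)
    show "w \<in> boxes p" if "w \<in> I_neg mu" "BN w \<inter> boxes p \<noteq> {}" for w
      using that I_rule unfolding p_simps by blast
    show "w \<in> boxes p" if "w \<in> II_bar mu i"
      "\<exists>n\<in>BN w \<inter> boxes p. \<not> (n \<in> III mu \<and> box_label p n = Some (axis_line i))" for w i
      using that II_rule unfolding p_simps(1) by blast
  qed (use III_rule in blast)+
  moreover have "AB_push mu (A, B) = AB_base mu p"
    unfolding AB_push_def AB_base_def p_simps using sub types_disjoint[of mu] by auto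
  ultimately show ?thesis by blast
qed

theorem theorem4p29:
  fixes mu :: "3 \<Rightarrow> nat list" and A B :: "cell set"
  assumes "\<And>i. is_partition (mu i)"
    and "AB_config mu (A, B)"
  shows "labelling_succeeds mu (A, B) \<longleftrightarrow> (A, B) \<in> AB_all mu"
  using labelled_box_config_if_colouring[OF assms(2)] colouring_if_labelled_box_config[OF assms]
    assms(2)
  unfolding labelling_succeeds_iff_colouring AB_all_def by blast

end
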